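(* Let $m\ge3$, $n\geq 2$ and $2\leq l\leq n-1$. Then $\chi^b_{(B(m,n),\sigma_l)}(\lambda)=\gamma_m^{n-l}\chi^b_{B^{uv}(m,l)}(\lambda)$, where $\gamma_m=\frac{(\lambda-1)^{m-1}-(-1)^{m-1}}{\lambda}$.
   Context: The book graph $B(m,n)$ has vertices $\{u,v\}\cup\{u_j^i:1\le i\le n,1\le j\le m-2\}$ and consists of the $n$ cycles $uu_1^i\cdots u_{m-2}^ivu$ sharing the edge $uv$. For $1\le l\le n$, $\sigma_l=\{uu_1^1,\ldots,uu_1^l\}$ is the set of negative edges of $(B(m,n),\sigma_l)$; $B^{uv}(m,l)$ is the signed graph on $B(m,l)$ whose only negative edge is $uv$. A zero-free coloring in $2k$ signed colors is a map $c:V\to\{-k,\ldots,-1,1,\ldots,k\}$, proper if $c(x)\ne\sigma(e)c(y)$ for every edge $e=xy$; the zero-free chromatic polynomial is the polynomial whose value at $\lambda=2k$ counts proper zero-free colorings. *)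

theory Defs
  imports "HOL-Library.FuncSet" "HOL-Computational_Algebra.Polynomial"
begin

record 'a signed_graph =
  verts :: "'a set"
  edges :: "'a set set"
  neg_edges :: "'a set set"

definition wf_signed_graph :: "'a signed_graph \<Rightarrow> bool" where
  "wf_signed_graph G \<longleftrightarrow> finite (verts G) \<and>
     (\<forall>e \<in> edges G. e \<subseteq> verts G \<and> card e = 2) \<and> neg_edges G \<subseteq> edges G"

definition edge_sign :: "'a signed_graph \<Rightarrow> 'a set \<Rightarrow> int" where
  "edge_sign G e = (if e \<in> neg_edges G then - 1 else 1)"

definition signed_colors :: "nat \<Rightarrow> int set" where
  "signed_colors k = {- int k..int k} - {0}"

text \<open>Colorings are extensional functions, so that each map on the vertex set is counted once.\<close>

definition proper_zero_free_colorings :: "'a signed_graph \<Rightarrow> nat \<Rightarrow> ('a \<Rightarrow> int) set" where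
  "proper_zero_free_colorings G k =
     {c \<in> verts G \<rightarrow>\<^sub>E signed_colors k.
        \<forall>x y. {x, y} \<in> edges G \<longrightarrow> c x \<noteq> edge_sign G {x, y} * c y}"

definition zero_free_chromatic_poly :: "'a signed_graph \<Rightarrow> real poly" where
  "zero_free_chromatic_poly G =
     (THE p. \<forall>k::nat. poly p (of_nat (2 * k)) = of_nat (card (proper_zero_free_colorings G k)))"

text \<open>\<open>Page i j\<close> is the vertex $u_j^i$: page \<open>i\<close>, position \<open>j\<close>.\<close>

datatype book_vertex = U | V | Page nat nat

definition book_verts :: "nat \<Rightarrow> nat \<Rightarrow> book_vertex set" where
  "book_verts m n = {U, V} \<union> {Page i j | i j. 1 \<le> i \<and> i \<le> n \<and> 1 \<le> j \<and> j \<le> m - 2}"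

text \<open>Meaningful for \<open>m \<ge> 3\<close> only: otherwise the pages have no interior vertices.\<close>

definition book_edges :: "nat \<Rightarrow> nat \<Rightarrow> book_vertex set set" where
  "book_edges m n = {{U, V}} \<union>
     (\<Union>i \<in> {1..n}. {{U, Page i 1}} \<union>
        {{Page i j, Page i (j + 1)} | j. 1 \<le> j \<and> j < m - 2} \<union>
        {{Page i (m - 2), V}})"

definition signed_book :: "nat \<Rightarrow> nat \<Rightarrow> book_vertex set set \<Rightarrow> book_vertex signed_graph" where
  "signed_book m n \<sigma> = \<lparr>verts = book_verts m n, edges = book_edges m n, neg_edges = \<sigma>\<rparr>"

definition sigma :: "nat \<Rightarrow> book_vertex set set" where
  "sigma l = {{U, Page i 1} | i. 1 \<le> i \<and> i \<le> l}"

definition book_uv :: "nat \<Rightarrow> nat \<Rightarrow> book_vertex signed_graph" where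
  "book_uv m l = signed_book m l {{U, V}}"

text \<open>The division by \<open>\<lambda> = [:0, 1:]\<close> is exact, see \<open>gamma_poly_exact\<close>.\<close>

definition gamma_poly :: "nat \<Rightarrow> real poly" where
  "gamma_poly m = ([:- 1, 1:] ^ (m - 1) - (- 1) ^ (m - 1)) div [:0, 1:]"

lemma gamma_poly_exact:
  "[:0, 1:] * gamma_poly m = [:- 1, 1:] ^ (m - 1) - (- 1) ^ (m - 1)"
proof -
  have "[:0, 1:] dvd ([:- 1, 1:] ^ (m - 1) - (- 1) ^ (m - 1) :: real poly)"
    using poly_eq_0_iff_dvd[of "[:- 1, 1:] ^ (m - 1) - (- 1) ^ (m - 1) :: real poly" 0]
    by simp
  then show ?thesis
    unfolding gamma_poly_def by (rule dvd_mult_div_cancel)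
qed

lemma zero_free_chromatic_poly_eqI:
  assumes "\<And>k. poly p (of_nat (2 * k)) = of_nat (card (proper_zero_free_colorings G k))"
  shows "zero_free_chromatic_poly G = p"
  unfolding zero_free_chromatic_poly_def
proof (rule the_equality)
  show "\<forall>k. poly p (of_nat (2 * k)) = of_nat (card (proper_zero_free_colorings G k))"
    using assms by blast
next
  fix q :: "real poly"
  assume q: "\<forall>k. poly q (of_nat (2 * k)) = of_nat (card (proper_zero_free_colorings G k))"
  have "range (\<lambda>k::nat. of_nat (2 * k)) \<subseteq> {x. poly (q - p) x = 0}"
    using q assms by auto
  moreover have "infinite (range (\<lambda>k::nat. of_nat (2 * k) :: real))"
    by (rule range_inj_infinite) (simp add: inj_def)
  ultimately have "infinite {x. poly (q - p) x = 0}"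
    using finite_subset by blast
  then show "q = p"
    using poly_roots_finite[of "q - p"] by auto
qed

lemma wf_signed_book:
  assumes "m \<ge> 3" and "\<sigma> \<subseteq> book_edges m n"
  shows "wf_signed_graph (signed_book m n \<sigma>)"
proof -
  have "book_verts m n \<subseteq> {U, V} \<union> (\<lambda>(i, j). Page i j) ` ({1..n} \<times> {1..m - 2})"
    unfolding book_verts_def by force
  then have "finite (book_verts m n)"
    by (rule finite_subset) simp
  moreover have "\<forall>e \<in> book_edges m n. e \<subseteq> book_verts m n \<and> card e = 2"
    using assms(1) unfolding book_edges_def book_verts_def by (auto simp: card_insert_if)
  ultimately show ?thesis
    using assms(2) unfolding wf_signed_graph_def signed_book_def by simp
qed

lemma sigma_subset_book_edges: "l \<le> n \<Longrightarrow> sigma l \<subseteq> book_edges m n"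
  unfolding sigma_def book_edges_def by fastforce

end

theory Submission
  imports Defs
begin

text \<open>
  Fix the colours \<open>a\<close> of \<open>U\<close> and \<open>b\<close> of \<open>V\<close>; the pages can then be coloured independently. An
  all-positive page has \<open>N a b\<close> colourings, where \<open>N a b = \<gamma>\<^sub>m\<close> if \<open>a \<noteq> b\<close> and
  \<open>N a a = \<gamma>\<^sub>m + (- 1)\<^sup>m\<^sup>-\<^sup>1\<close>, and a page whose edge at \<open>U\<close> is negative has \<open>N (- a) b\<close>.
  So \<open>(B(m,n), \<sigma>\<^sub>l)\<close> has \<open>\<gamma>\<^sub>m\<^sup>n\<^sup>-\<^sup>l \<Sum>\<^bsub>a \<noteq> b\<^esub> N (- a) b\<^sup>l\<close> proper colourings, while \<open>B\<^sup>u\<^sup>v(m,l)\<close> has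
  \<open>\<Sum>\<^bsub>a \<noteq> - b\<^esub> N a b\<^sup>l\<close>, and switching the sign of \<open>a\<close> identifies the two sums.
\<close>

section \<open>Colourings of a single page\<close>

text \<open>The interior of a page is a path of positive edges, so no negation on \<open>C\<close>
  is required. The sign of the edge at \<open>U\<close> is absorbed into \<open>a\<close>, the
  colour which that edge forbids at the first vertex.\<close>

definition page_colorings :: "'c set \<Rightarrow> nat \<Rightarrow> 'c \<Rightarrow> 'c \<Rightarrow> (nat \<Rightarrow> 'c) set" where
  "page_colorings C p a b =
     {f \<in> {1..p} \<rightarrow>\<^sub>E C. f 1 \<noteq> a \<and> (\<forall>j. 1 \<le> j \<and> j < p \<longrightarrow> f j \<noteq> f (j + 1)) \<and> f p \<noteq> b}"

lemma finite_page_colorings: "finite C \<Longrightarrow> finite (page_colorings C p a b)"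
  unfolding page_colorings_def by (simp add: finite_PiE)

lemma card_page_colorings_1: "card (page_colorings C 1 a b) = card (C - {a, b})"
proof -
  have "bij_betw (\<lambda>f. f 1) (page_colorings C 1 a b) (C - {a, b})"
    by (rule bij_betw_byWitness[where f' = "\<lambda>c. \<lambda>j\<in>{1}. c"])
       (auto simp: page_colorings_def PiE_iff extensional_def fun_eq_iff)
  then show ?thesis
    by (rule bij_betw_same_card)
qed

text \<open>Deleting the last vertex turns its colour \<open>c\<close> into the colour forbidden at
  the new end of the path; \<open>c\<close> itself has to avoid \<open>b\<close>.\<close>

lemma card_page_colorings_Suc:
  assumes "finite C" and "p \<ge> 1"
  shows "card (page_colorings C (Suc p) a b) = (\<Sum>c\<in>C - {b}. card (page_colorings C p a c))"
proof -
  have "bij_betw (\<lambda>f. (f (Suc p), restrict f {1..p})) (page_colorings C (Suc p) a b)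
          (Sigma (C - {b}) (page_colorings C p a))"
  proof (rule bij_betw_byWitness[where f' = "\<lambda>(c, f). f(Suc p := c)"])
    show "\<forall>f\<in>page_colorings C (Suc p) a b.
            (\<lambda>(c, f). f(Suc p := c)) (f (Suc p), restrict f {1..p}) = f"
      by (fastforce simp: page_colorings_def PiE_iff extensional_def fun_eq_iff)
    show "\<forall>x\<in>Sigma (C - {b}) (page_colorings C p a).
            (\<lambda>f. (f (Suc p), restrict f {1..p})) ((\<lambda>(c, f). f(Suc p := c)) x) = x"
      by (auto simp: page_colorings_def PiE_iff extensional_def fun_eq_iff)
    show "(\<lambda>f. (f (Suc p), restrict f {1..p})) ` page_colorings C (Suc p) a b
            \<subseteq> Sigma (C - {b}) (page_colorings C p a)"
      using assms(2) by (fastforce simp: page_colorings_def PiE_iff)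
    show "(\<lambda>(c, f). f(Suc p := c)) ` Sigma (C - {b}) (page_colorings C p a)
            \<subseteq> page_colorings C (Suc p) a b"
      using assms(2)
      by (auto simp: page_colorings_def PiE_iff extensional_def less_Suc_eq)
  qed
  then show ?thesis
    using assms(1) by (simp add: bij_betw_same_card finite_page_colorings)
qed

section \<open>The recurrence for \<open>gamma_poly\<close> and the size of
  \<open>page_colorings\<close>\<close>

text \<open>Multiplication by \<lambda> undoes both divisions, and the sign terms combine through
  \<lambda> - (\<lambda> - 1) = 1. With \<open>m = p + 2\<close> this matches the recursion of
  \<open>card_page_colorings_Suc\<close> for \<open>a \<noteq> b\<close>.\<close>

lemma gamma_poly_Suc:
  assumes "m \<ge> 1"
  shows "gamma_poly (Suc m) = [:- 1, 1:] * gamma_poly m + (- 1) ^ (m - 1)"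
proof -
  obtain r where r: "m = Suc r"
    using assms by (cases m) auto
  have "[:0, 1:] * ([:- 1, 1:] * gamma_poly m + (- 1) ^ (m - 1)) =
        [:- 1, 1:] * ([:0, 1:] * gamma_poly m) + [:0, 1:] * (- 1) ^ (m - 1)"
    by (simp only: algebra_simps)
  also have "\<dots> = [:- 1, 1:] ^ m + ([:0, 1:] - [:- 1, 1:]) * (- 1) ^ r"
    unfolding gamma_poly_exact by (simp only: r algebra_simps diff_Suc_1 power_Suc)
  also have "[:0, 1:] - [:- 1, 1:] = (1 :: real poly)"
    by (simp add: one_pCons)
  also have "[:- 1, 1:] ^ m + 1 * (- 1) ^ r = [:0, 1:] * gamma_poly (Suc m)"
    unfolding gamma_poly_exact by (simp add: r)
  finally show ?thesis
    by (metis mult_left_cancel pCons_eq_0_iff zero_neq_one)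
qed

lemma gamma_poly_1: "gamma_poly 1 = 0"
  by (simp add: gamma_poly_def)

text \<open>A page with \<open>p\<close> interior vertices lies on a cycle of length
  \<open>p + 2\<close>, hence the index. The induction removes the vertex next to \<open>V\<close>,
  so \<open>b\<close> varies while \<open>a\<close> stays fixed.\<close>

lemma card_page_colorings:
  assumes "finite C" and "p \<ge> 1" and "a \<in> C" and "b \<in> C"
  shows "real (card (page_colorings C p a b)) =
         poly (gamma_poly (p + 2)) (real (card C)) + (if a = b then (- 1) ^ (p + 1) else 0)"
  using assms(2,4)
proof (induction p arbitrary: b rule: nat_induct_at_least)
  case base
  have "card {a, b} \<le> card C"
    using assms base by (intro card_mono) auto
  then have "real (card (C - {a, b})) = real (card C) - real (card {a, b})"
    using assms base by (subst card_Diff_subset) auto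
  \<comment> \<open>From \<gamma>_1 = 0 the recurrence gives \<gamma>_2 = 1 and then \<gamma>_3 =
    \<lambda> - 2.\<close>
  moreover have "poly (gamma_poly (1 + 2)) x = x - 2" for x
    using gamma_poly_Suc[of 1] gamma_poly_Suc[of 2] gamma_poly_1
    by (simp add: numeral_eq_Suc)
  ultimately show ?case
    by (simp add: card_page_colorings_1[unfolded One_nat_def])
next
  case (Suc p)
  define q where "q = real (card C)"
  define g where "g = poly (gamma_poly (p + 2)) q"
  have card_rest: "real (card (C - {b})) = q - 1"
    using assms(1) Suc.prems card_gt_0_iff[of C]
    by (auto simp: q_def card_Diff_singleton of_nat_diff)
  have "real (card (page_colorings C (Suc p) a b)) =
        (\<Sum>c\<in>C - {b}. g + (if a = c then (- 1) ^ (p + 1) else 0))"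
    unfolding card_page_colorings_Suc[OF assms(1) Suc.hyps] of_nat_sum g_def q_def
    by (rule sum.cong) (use Suc.IH in blast)+
  \<comment> \<open>The colour \<open>c = a\<close> lies in \<open>C - {b}\<close> only if
    \<open>a \<noteq> b\<close>, so the correction now sits off the diagonal. Absorbing it into the
    next \<gamma> returns it to the diagonal with the opposite sign.\<close>
  also have "\<dots> = (q - 1) * g + (if a = b then 0 else (- 1) ^ (p + 1))"
    using assms(1,3) card_rest by (auto simp: sum.distrib sum.delta)
  also have "\<dots> = poly (gamma_poly (Suc p + 2)) q + (if a = b then (- 1) ^ (Suc p + 1) else 0)"
  proof -
    have "poly (gamma_poly (Suc p + 2)) q = (q - 1) * g + (- 1) ^ (p + 1)"
      using gamma_poly_Suc[of "p + 2"] by (simp add: g_def left_diff_distrib)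
    then show ?thesis
      by simp
  qed
  finally show ?case
    by (simp add: q_def)
qed

section \<open>Splitting a signed book into independent pages\<close>

text \<open>A sign is its own inverse, so each edge can be checked in one orientation; page edges at
  \<open>U\<close> are oriented to put the sign on \<open>c U\<close>. The assumption on \<sigma>
  makes every edge avoiding \<open>U\<close> positive and covers both signatures of
  interest.\<close>

lemma proper_book_iff:
  assumes "m \<ge> 3" and "\<sigma> \<subseteq> range (\<lambda>x. {U, x})"
  shows "(\<forall>x y. {x, y} \<in> edges (signed_book m n \<sigma>) \<longrightarrow>
            c x \<noteq> edge_sign (signed_book m n \<sigma>) {x, y} * c y) \<longleftrightarrow>
         c U \<noteq> edge_sign (signed_book m n \<sigma>) {U, V} * c V \<and>
         (\<forall>i\<in>{1..n}. c (Page i 1) \<noteq> edge_sign (signed_book m n \<sigma>) {U, Page i 1} * c U \<and>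
            (\<forall>j. 1 \<le> j \<and> j < m - 2 \<longrightarrow> c (Page i j) \<noteq> c (Page i (j + 1))) \<and>
            c (Page i (m - 2)) \<noteq> c V)"
    (is "?L \<longleftrightarrow> ?R")
proof -
  let ?G = "signed_book m n \<sigma>"
  define ok where "ok x y \<longleftrightarrow> c x \<noteq> edge_sign ?G {x, y} * c y" for x y
  have sym: "ok x y \<longleftrightarrow> ok y x" for x y
    by (auto simp: ok_def edge_sign_def insert_commute)
  have plain: "ok x y \<longleftrightarrow> c x \<noteq> c y" if "x \<noteq> U" "y \<noteq> U" for x y
  proof -
    have "{x, y} \<notin> \<sigma>"
      using assms(2) that by (auto simp: doubleton_eq_iff)
    then show ?thesis
      by (simp add: ok_def edge_sign_def signed_book_def)
  qed
  have "?L \<longleftrightarrow> (\<forall>x y. {x, y} \<in> book_edges m n \<longrightarrow> ok x y)"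
    by (simp add: ok_def signed_book_def)
  also have "\<dots> \<longleftrightarrow> ok U V \<and> (\<forall>i\<in>{1..n}. ok (Page i 1) U \<and>
      (\<forall>j. 1 \<le> j \<and> j < m - 2 \<longrightarrow> ok (Page i j) (Page i (j + 1))) \<and> ok (Page i (m - 2)) V)"
    (is "_ \<longleftrightarrow> ?M")
  proof
    assume L: "\<forall>x y. {x, y} \<in> book_edges m n \<longrightarrow> ok x y"
    have "{U, V} \<in> book_edges m n"
      by (simp add: book_edges_def)
    moreover have "{Page i 1, U} \<in> book_edges m n" "{Page i (m - 2), V} \<in> book_edges m n"
      if "i \<in> {1..n}" for i
      using that by (auto simp: book_edges_def insert_commute)
    moreover have "{Page i j, Page i (j + 1)} \<in> book_edges m n"
      if "i \<in> {1..n}" "1 \<le> j \<and> j < m - 2" for i j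
      using that unfolding book_edges_def by blast
    ultimately show ?M
      using L by blast
  next
    assume M: ?M
    show "\<forall>x y. {x, y} \<in> book_edges m n \<longrightarrow> ok x y"
    proof (intro allI impI)
      fix x y
      assume "{x, y} \<in> book_edges m n"
      then consider "{x, y} = {U, V}"
        | i where "i \<in> {1..n}" "{x, y} = {Page i 1, U}"
        | i j where "i \<in> {1..n}" "1 \<le> j \<and> j < m - 2" "{x, y} = {Page i j, Page i (j + 1)}"
        | i where "i \<in> {1..n}" "{x, y} = {Page i (m - 2), V}"
        unfolding book_edges_def by (auto simp: insert_commute)
      then show "ok x y"
        by cases (use M sym in \<open>auto simp: doubleton_eq_iff\<close>)
    qed
  qed
  also have "\<dots> \<longleftrightarrow> ?R"
    by (simp add: plain) (simp add: ok_def insert_commute)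
  finally show ?thesis .
qed

lemma finite_signed_colors: "finite (signed_colors k)"
  by (simp add: signed_colors_def)

lemma card_signed_colors: "card (signed_colors k) = 2 * k"
  by (simp add: signed_colors_def card_Diff_singleton)

lemma card_proper_book:
  fixes m n k :: nat and \<sigma> :: "book_vertex set set"
  defines "C \<equiv> signed_colors k" and "s \<equiv> edge_sign (signed_book m n \<sigma>)"
  assumes "m \<ge> 3" and "\<sigma> \<subseteq> range (\<lambda>x. {U, x})"
  shows "card (proper_zero_free_colorings (signed_book m n \<sigma>) k) =
         (\<Sum>a\<in>C. \<Sum>b | b \<in> C \<and> a \<noteq> s {U, V} * b.
            \<Prod>i\<in>{1..n}. card (page_colorings C (m - 2) (s {U, Page i 1} * a) b))"
proof -
  define P where
    "P a b = (\<Pi>\<^sub>E i\<in>{1..n}. page_colorings C (m - 2) (s {U, Page i 1} * a) b)" for a b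
  define S where "S = (SIGMA a:C. SIGMA b:{b \<in> C. a \<noteq> s {U, V} * b}. P a b)"
  define split_pages :: "(book_vertex \<Rightarrow> int) \<Rightarrow> _" where
    "split_pages c = (c U, c V, \<lambda>i\<in>{1..n}. \<lambda>j\<in>{1..m - 2}. c (Page i j))" for c
  \<comment> \<open>The restrictions here and in \<open>split_pages\<close> supply the default value
    outside the domains, which makes the two maps mutually inverse on extensional functions.\<close>
  define join_pages :: "int \<times> int \<times> (nat \<Rightarrow> nat \<Rightarrow> int) \<Rightarrow> book_vertex \<Rightarrow> int" where
    "join_pages = (\<lambda>(a, b, f). restrict (case_book_vertex a b f) (book_verts m n))"
  have verts: "U \<in> book_verts m n" "V \<in> book_verts m n"
    "Page i j \<in> book_verts m n \<longleftrightarrow> i \<in> {1..n} \<and> j \<in> {1..m - 2}" for i j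
    by (auto simp: book_verts_def)
  have proper: "proper_zero_free_colorings (signed_book m n \<sigma>) k =
      {c \<in> book_verts m n \<rightarrow>\<^sub>E C. c U \<noteq> s {U, V} * c V \<and>
         (\<forall>i\<in>{1..n}. c (Page i 1) \<noteq> s {U, Page i 1} * c U \<and>
            (\<forall>j. 1 \<le> j \<and> j < m - 2 \<longrightarrow> c (Page i j) \<noteq> c (Page i (j + 1))) \<and>
            c (Page i (m - 2)) \<noteq> c V)}"
    unfolding proper_zero_free_colorings_def proper_book_iff[OF assms(3,4)] C_def s_def
    by (simp add: signed_book_def)
  have "bij_betw split_pages (proper_zero_free_colorings (signed_book m n \<sigma>) k) S"
  proof (rule bij_betw_byWitness[where f' = join_pages])
    show "\<forall>c\<in>proper_zero_free_colorings (signed_book m n \<sigma>) k. join_pages (split_pages c) = c"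
    proof
      fix c
      assume "c \<in> proper_zero_free_colorings (signed_book m n \<sigma>) k"
      then have "c \<in> extensional (book_verts m n)"
        by (simp add: proper PiE_iff)
      then show "join_pages (split_pages c) = c"
        by (auto simp: join_pages_def split_pages_def fun_eq_iff verts extensional_def
            split: book_vertex.split)
    qed
    show "\<forall>x\<in>S. split_pages (join_pages x) = x"
    proof
      fix x
      assume "x \<in> S"
      then obtain a b f where x: "x = (a, b, f)" and f: "f \<in> P a b"
        by (auto simp: S_def)
      have "f \<in> extensional {1..n}" "\<forall>i\<in>{1..n}. f i \<in> extensional {1..m - 2}"
        using f by (auto simp: P_def PiE_iff page_colorings_def)
      then show "split_pages (join_pages x) = x"
        by (auto simp: x join_pages_def split_pages_def fun_eq_iff verts extensional_def)
    qed
    show "split_pages ` proper_zero_free_colorings (signed_book m n \<sigma>) k \<subseteq> S"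
    proof
      fix x
      assume "x \<in> split_pages ` proper_zero_free_colorings (signed_book m n \<sigma>) k"
      then obtain c where x: "x = split_pages c"
        and c: "c \<in> proper_zero_free_colorings (signed_book m n \<sigma>) k"
        by blast
      have "c v \<in> C" if "v \<in> book_verts m n" for v
        using c that by (auto simp: proper)
      \<comment> \<open>Positions \<open>1\<close> and \<open>m - 2\<close> thus lie in the page, so
        the conditions at \<open>U\<close> and \<open>V\<close> survive the restriction.\<close>
      moreover have "Suc 0 \<le> m - 2"
        using \<open>m \<ge> 3\<close> by simp
      ultimately show "x \<in> S"
        using c
        by (auto simp: x proper split_pages_def S_def P_def page_colorings_def verts)
    qed
    show "join_pages ` S \<subseteq> proper_zero_free_colorings (signed_book m n \<sigma>) k"
    proof
      fix c
      assume "c \<in> join_pages ` S"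
      then obtain a b f where c: "c = join_pages (a, b, f)"
        and ab: "a \<in> C" "b \<in> C" "a \<noteq> s {U, V} * b" and f: "f \<in> P a b"
        by (auto simp: S_def)
      have fi: "f i \<in> page_colorings C (m - 2) (s {U, Page i 1} * a) b" if "i \<in> {1..n}" for i
        using f that unfolding P_def by (rule PiE_mem)
      have cv: "c U = a" "c V = b"
        "\<And>i j. i \<in> {1..n} \<Longrightarrow> j \<in> {1..m - 2} \<Longrightarrow> c (Page i j) = f i j"
        by (simp_all add: c join_pages_def verts)
      have "c \<in> book_verts m n \<rightarrow>\<^sub>E C"
      proof (rule PiE_I)
        show "c v \<in> C" if "v \<in> book_verts m n" for v
        proof (cases v)
          case (Page i j)
          then have ij: "i \<in> {1..n}" "j \<in> {1..m - 2}"
            using that verts(3) by auto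
          then have "f i j \<in> C"
            using fi[of i] by (auto simp: page_colorings_def)
          then show ?thesis
            using cv(3)[OF ij] Page by simp
        qed (use cv ab in auto)
      qed (simp add: c join_pages_def)
      moreover have "c (Page i 1) \<noteq> s {U, Page i 1} * c U \<and>
            (\<forall>j. 1 \<le> j \<and> j < m - 2 \<longrightarrow> c (Page i j) \<noteq> c (Page i (j + 1))) \<and>
            c (Page i (m - 2)) \<noteq> c V" if "i \<in> {1..n}" for i
        using fi[OF that] that \<open>m \<ge> 3\<close> by (simp add: page_colorings_def cv)
      ultimately show "c \<in> proper_zero_free_colorings (signed_book m n \<sigma>) k"
        using ab by (simp add: proper cv)
    qed
  qed
  then have "card (proper_zero_free_colorings (signed_book m n \<sigma>) k) = card S"
    by (rule bij_betw_same_card)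
  also have "\<dots> = (\<Sum>a\<in>C. \<Sum>b | b \<in> C \<and> a \<noteq> s {U, V} * b. card (P a b))"
    unfolding S_def P_def C_def
    by (simp add: finite_signed_colors finite_PiE finite_page_colorings)
  also have "\<dots> = (\<Sum>a\<in>C. \<Sum>b | b \<in> C \<and> a \<noteq> s {U, V} * b.
            \<Prod>i\<in>{1..n}. card (page_colorings C (m - 2) (s {U, Page i 1} * a) b))"
    by (simp add: P_def card_PiE)
  finally show ?thesis .
qed

section \<open>Counting and comparing the two signed books\<close>

lemma card_proper_book_uv:
  assumes "m \<ge> 3"
  shows "card (proper_zero_free_colorings (book_uv m l) k) =
         (\<Sum>a\<in>signed_colors k. \<Sum>b | b \<in> signed_colors k \<and> a \<noteq> - b.
            card (page_colorings (signed_colors k) (m - 2) a b) ^ l)"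
proof -
  have sign: "edge_sign (signed_book m l {{U, V}}) {U, V} = - 1"
    "edge_sign (signed_book m l {{U, V}}) {U, Page i 1} = 1" for i
    by (auto simp: edge_sign_def signed_book_def doubleton_eq_iff)
  show ?thesis
    unfolding book_uv_def by (subst card_proper_book) (use assms sign in auto)
qed

lemma card_proper_book_sigma:
  assumes "m \<ge> 3" and "l \<le> n"
  shows "card (proper_zero_free_colorings (signed_book m n (sigma l)) k) =
         (\<Sum>a\<in>signed_colors k. \<Sum>b | b \<in> signed_colors k \<and> a \<noteq> b.
            card (page_colorings (signed_colors k) (m - 2) (- a) b) ^ l *
            card (page_colorings (signed_colors k) (m - 2) a b) ^ (n - l))"
proof -
  let ?s = "edge_sign (signed_book m n (sigma l))"
  have uv: "?s {U, V} = 1"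
    by (auto simp: edge_sign_def signed_book_def sigma_def doubleton_eq_iff)
  have page: "?s {U, Page i 1} = (if i \<le> l then - 1 else 1)" if "i \<ge> 1" for i
    using that by (auto simp: edge_sign_def signed_book_def sigma_def doubleton_eq_iff)
  \<comment> \<open>\<open>F\<close> stands for the page count as a function of the sign at
    \<open>U\<close>; the page number matters only through this sign.\<close>
  have prod: "(\<Prod>i\<in>{1..n}. F (?s {U, Page i 1})) = F (- 1) ^ l * F 1 ^ (n - l)"
    for F :: "int \<Rightarrow> nat"
  proof -
    have "{1..n} = {1..l} \<union> {l + 1..n}" "{1..l} \<inter> {l + 1..n} = {}"
      using assms(2) by auto
    then have "(\<Prod>i\<in>{1..n}. F (?s {U, Page i 1})) =
        (\<Prod>i\<in>{1..l}. F (?s {U, Page i 1})) * (\<Prod>i\<in>{l + 1..n}. F (?s {U, Page i 1}))"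
      by (simp add: prod.union_disjoint)
    also have "(\<Prod>i\<in>{1..l}. F (?s {U, Page i 1})) = (\<Prod>i\<in>{1..l}. F (- 1))"
      by (rule prod.cong) (use page in auto)
    also have "(\<Prod>i\<in>{l + 1..n}. F (?s {U, Page i 1})) = (\<Prod>i\<in>{l + 1..n}. F 1)"
      by (rule prod.cong) (use page in auto)
    finally show ?thesis
      by simp
  qed
  have "sigma l \<subseteq> range (\<lambda>x. {U, x})"
    by (auto simp: sigma_def)
  from card_proper_book[OF assms(1) this, where n = n and k = k]
  show ?thesis
    unfolding uv
      prod[of "\<lambda>t. card (page_colorings (signed_colors k) (m - 2) (t * _) _)"]
    by simp
qed

lemma card_book_sigma_eq:
  assumes "m \<ge> 3" and "l \<le> n"
  shows "real (card (proper_zero_free_colorings (signed_book m n (sigma l)) k)) =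
         poly (gamma_poly m) (real (2 * k)) ^ (n - l) *
         real (card (proper_zero_free_colorings (book_uv m l) k))"
proof -
  let ?C = "signed_colors k"
  let ?N = "\<lambda>a b. real (card (page_colorings ?C (m - 2) a b))"
  \<comment> \<open>The positive edge \<open>{U, V}\<close> forces \<open>a \<noteq> b\<close>, so
    the diagonal correction never arises on positive pages and their contribution is a constant
    factor.\<close>
  have positive_page: "?N a b = poly (gamma_poly m) (real (2 * k))"
    if "a \<in> ?C" "b \<in> ?C" "a \<noteq> b" for a b
  proof -
    have "m - 2 + 2 = m"
      using assms(1) by simp
    then show ?thesis
      using card_page_colorings[OF finite_signed_colors, of "m - 2" a k b] that assms(1)
      by (simp only: card_signed_colors) simp
  qed
  have "real (card (proper_zero_free_colorings (signed_book m n (sigma l)) k)) =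
      (\<Sum>a\<in>?C. \<Sum>b | b \<in> ?C \<and> a \<noteq> b. ?N (- a) b ^ l * ?N a b ^ (n - l))"
    by (simp add: card_proper_book_sigma[OF assms])
  also have "\<dots> = (\<Sum>a\<in>?C. \<Sum>b | b \<in> ?C \<and> a \<noteq> b.
      poly (gamma_poly m) (real (2 * k)) ^ (n - l) * ?N (- a) b ^ l)"
    by (intro sum.cong refl) (simp add: positive_page)
  also have "\<dots> = poly (gamma_poly m) (real (2 * k)) ^ (n - l) *
      (\<Sum>a\<in>?C. \<Sum>b | b \<in> ?C \<and> a \<noteq> b. ?N (- a) b ^ l)"
    by (simp only: sum_distrib_left)
  \<comment> \<open>Switching at \<open>U\<close>: the colour set is closed under negation, and
    \<open>a \<noteq> b\<close> turns into \<open>a \<noteq> - b\<close>.\<close>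
  also have "(\<Sum>a\<in>?C. \<Sum>b | b \<in> ?C \<and> a \<noteq> b. ?N (- a) b ^ l) =
      (\<Sum>a\<in>?C. \<Sum>b | b \<in> ?C \<and> a \<noteq> - b. ?N a b ^ l)"
    by (rule sum.reindex_bij_witness[where i = uminus and j = uminus])
       (auto simp: signed_colors_def minus_equation_iff intro!: sum.cong)
  also have "\<dots> = real (card (proper_zero_free_colorings (book_uv m l) k))"
    by (simp add: card_proper_book_uv[OF assms(1)])
  finally show ?thesis .
qed

section \<open>From counts to chromatic polynomials\<close>

text \<open>
  The two summands count the colourings with \<open>a \<noteq> \<plusminus>b\<close> and those with \<open>a = b\<close>, where \<open>a\<close> and \<open>b\<close>
  are the colours of \<open>U\<close> and \<open>V\<close>.
\<close>

lemma card_book_uv_poly: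
  assumes "m \<ge> 3"
  shows "poly ([:0, 1:] * [:- 2, 1:] * gamma_poly m ^ l +
               [:0, 1:] * (gamma_poly m + (- 1) ^ (m - 1)) ^ l) (of_nat (2 * k)) =
         real (card (proper_zero_free_colorings (book_uv m l) k))"
proof -
  let ?C = "signed_colors k"
  let ?N = "\<lambda>a b. real (card (page_colorings ?C (m - 2) a b))"
  define g where "g = poly (gamma_poly m) (real (2 * k))"
  have N: "?N a b = g + (if a = b then (- 1) ^ (m - 1) else 0)" if "a \<in> ?C" "b \<in> ?C" for a b
  proof -
    have "m - 2 + 2 = m" "m - 2 + 1 = m - 1"
      using assms by auto
    then show ?thesis
      using card_page_colorings[OF finite_signed_colors, of "m - 2" a k b] that assms
      by (simp only: card_signed_colors g_def)
  qed
  have inner: "(\<Sum>b | b \<in> ?C \<and> a \<noteq> - b. ?N a b ^ l) =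
      (real (2 * k) - 2) * g ^ l + (g + (- 1) ^ (m - 1)) ^ l" if a: "a \<in> ?C" for a
  proof -
    \<comment> \<open>As \<open>0\<close> is not a colour, \<open>a\<close> and \<open>- a\<close>
      differ: \<open>b = - a\<close> is forbidden, \<open>b = a\<close> is allowed, and
      \<open>2 * k - 2\<close> other choices remain.\<close>
    have minus: "- a \<in> ?C" "a \<noteq> - a"
      using a by (auto simp: signed_colors_def)
    have "{b. b \<in> ?C \<and> a \<noteq> - b} = insert a (?C - {a, - a})"
      using a minus by auto
    then have "(\<Sum>b | b \<in> ?C \<and> a \<noteq> - b. ?N a b ^ l) =
        ?N a a ^ l + (\<Sum>b\<in>?C - {a, - a}. ?N a b ^ l)"
      by (simp add: finite_signed_colors)
    also have "(\<Sum>b\<in>?C - {a, - a}. ?N a b ^ l) = (\<Sum>b\<in>?C - {a, - a}. g ^ l)"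
      by (rule sum.cong) (use N a in auto)
    also have "\<dots> = (real (2 * k) - 2) * g ^ l"
    proof -
      have "card {a, - a} = 2"
        using minus by simp
      moreover have "card {a, - a} \<le> card ?C"
        using a minus by (intro card_mono finite_signed_colors) auto
      moreover have "card (?C - {a, - a}) = card ?C - card {a, - a}"
        using a minus by (intro card_Diff_subset) auto
      ultimately show ?thesis
        by (simp add: card_signed_colors of_nat_diff)
    qed
    finally show ?thesis
      using N[OF a a] by simp
  qed
  have "real (card (proper_zero_free_colorings (book_uv m l) k)) =
      (\<Sum>a\<in>?C. \<Sum>b | b \<in> ?C \<and> a \<noteq> - b. ?N a b ^ l)"
    by (simp add: card_proper_book_uv[OF assms])
  also have "\<dots> = real (2 * k) * ((real (2 * k) - 2) * g ^ l + (g + (- 1) ^ (m - 1)) ^ l)"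
    by (simp add: inner card_signed_colors)
  finally show ?thesis
    by (simp add: g_def algebra_simps)
qed

theorem theorem4p7:
  fixes m n l :: nat
  assumes "m \<ge> 3" and "n \<ge> 2" and "2 \<le> l" and "l \<le> n - 1"
  shows "zero_free_chromatic_poly (signed_book m n (sigma l)) =
         gamma_poly m ^ (n - l) * zero_free_chromatic_poly (book_uv m l)"
proof (rule zero_free_chromatic_poly_eqI)
  fix k
  have "l \<le> n"
    using assms by simp
  then show "poly (gamma_poly m ^ (n - l) * zero_free_chromatic_poly (book_uv m l))
      (of_nat (2 * k)) =
    of_nat (card (proper_zero_free_colorings (signed_book m n (sigma l)) k))"
    \<comment> \<open>The description defining the polynomial of \<open>book_uv m l\<close> is
      resolved by the explicit polynomial that attains its counts; evaluating that polynomial at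
      \<open>2 * k\<close> then gives the count back.\<close>
    unfolding zero_free_chromatic_poly_eqI[OF card_book_uv_poly[OF assms(1)]]
    unfolding poly_mult[of "gamma_poly m ^ (n - l)"] card_book_uv_poly[OF assms(1)]
    by (simp add: card_book_sigma_eq[OF assms(1)])
qed

end
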